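(* Consider the adversarial task allocation game with heterogeneous tasks having utilities $u_t\ge0$, $t\in T$, and $n\ge 2$ workers with proficiencies $1\ge p_1\ge p_2\ge\dots\ge p_n\ge\tfrac12$, where the defender is restricted to randomized strategies supported on assignments that assign exactly one worker to each task, and the attacker observes only the randomized strategy. Let $k^*$ be the smallest maximizer of $\dfrac{k-1}{\sum_{j=1}^{k}1/p_j}$ over $k\in\{2,\dots,n\}$, and define $$\lambda^*_i=\frac{1}{p_i\sum_{j=1}^{k^*}1/p_j}\quad (1\le i\le k^* ),\qquad \lambda^*_i=0\quad (i>k^* ).$$ Then the randomized strategy that, with probability $\lambda^*_i$, assigns all tasks to worker $i$ is optimal for the defender among all such restricted randomized strategies. In particular, given $p_1\ge\dots\ge p_n$ in sorted order, an optimal restricted randomized assignment can be computed in time linear in $n$ (counting arithmetic operations and comparisons).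
   Context: There are $n$ workers and a finite set $T$ of $m$ binary labeling tasks; worker $w$ completes any task correctly with probability $p_w$. An assignment with one worker per task is a binary matrix $s=(s_{wt})$ with $\sum_w s_{wt}=1$ for every $t\in T$, where $s_{wt}=1$ iff task $t$ is assigned to worker $w$. The defender obtains $u_t$ if task $t$ is completed correctly and $0$ otherwise. The attacker attacks exactly one worker $a$; the defender gets zero utility from the tasks assigned to $a$. Hence the defender's expected utility under assignment $s$ and attack $a$ is $u_{def}(s,a)=\sum_{w\ne a}p_w\sum_{t}s_{wt}u_t$. The game is zero-sum. A randomized strategy is a probability distribution $q$ over such assignments $s$; the attacker knows $q$ but not its realization and best responds; $q$ is optimal if it maximizes $\min_a\sum_s q_s\,u_{def}(s,a)$ over all such $q$. *)

theory Defs
  imports "HOL-Probability.Probability_Mass_Function"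
begin

section \<open>The task allocation game\<close>

text \<open>Workers are the numbers \<open>1, \<dots>, n\<close>; \<open>p w\<close> is the proficiency of worker \<open>w\<close>.\<close>

definition proficiencies :: "nat \<Rightarrow> (nat \<Rightarrow> real) \<Rightarrow> bool" where
  "proficiencies n p \<longleftrightarrow> n \<ge> 2 \<and> (\<forall>w\<in>{1..n}. 1 / 2 \<le> p w \<and> p w \<le> 1) \<and> antimono_on {1..n} p"

definition task_utilities :: "'t set \<Rightarrow> ('t \<Rightarrow> real) \<Rightarrow> bool" where
  "task_utilities T u \<longleftrightarrow> finite T \<and> (\<forall>t\<in>T. 0 \<le> u t)"

text \<open>Binary worker-by-task matrices with exactly one worker per task. The last condition fixes
  the irrelevant entries, so that an assignment is determined by its \<open>n \<times> T\<close> matrix.\<close>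

definition assignments :: "nat \<Rightarrow> 't set \<Rightarrow> (nat \<Rightarrow> 't \<Rightarrow> real) set" where
  "assignments n T = {s. (\<forall>w\<in>{1..n}. \<forall>t\<in>T. s w t \<in> {0, 1}) \<and>
     (\<forall>t\<in>T. (\<Sum>w=1..n. s w t) = 1) \<and>
     (\<forall>w t. w \<notin> {1..n} \<or> t \<notin> T \<longrightarrow> s w t = 0)}"

definition defender_utility :: "nat \<Rightarrow> (nat \<Rightarrow> real) \<Rightarrow> 't set \<Rightarrow> ('t \<Rightarrow> real) \<Rightarrow> (nat \<Rightarrow> 't \<Rightarrow> real) \<Rightarrow> nat \<Rightarrow> real" where
  "defender_utility n p T u s a = (\<Sum>w\<in>{1..n} - {a}. p w * (\<Sum>t\<in>T. s w t * u t))"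

definition randomized_strategy :: "nat \<Rightarrow> 't set \<Rightarrow> (nat \<Rightarrow> 't \<Rightarrow> real) pmf \<Rightarrow> bool" where
  "randomized_strategy n T q \<longleftrightarrow> set_pmf q \<subseteq> assignments n T"

definition guaranteed_utility ::
    "nat \<Rightarrow> (nat \<Rightarrow> real) \<Rightarrow> 't set \<Rightarrow> ('t \<Rightarrow> real) \<Rightarrow> (nat \<Rightarrow> 't \<Rightarrow> real) pmf \<Rightarrow> real" where
  "guaranteed_utility n p T u q =
     Min ((\<lambda>a. measure_pmf.expectation q (\<lambda>s. defender_utility n p T u s a)) ` {1..n})"

definition optimal_strategy ::
    "nat \<Rightarrow> (nat \<Rightarrow> real) \<Rightarrow> 't set \<Rightarrow> ('t \<Rightarrow> real) \<Rightarrow> (nat \<Rightarrow> 't \<Rightarrow> real) pmf \<Rightarrow> bool" where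
  "optimal_strategy n p T u q \<longleftrightarrow>
     is_arg_max (guaranteed_utility n p T u) (randomized_strategy n T) q"

definition all_to_worker :: "'t set \<Rightarrow> nat \<Rightarrow> (nat \<Rightarrow> 't \<Rightarrow> real)" where
  "all_to_worker T i = (\<lambda>w t. if w = i \<and> t \<in> T then 1 else 0)"

text \<open>The numbers \<open>l 1, \<dots>, l n\<close> form a probability vector, and assigning all tasks to
  worker \<open>i\<close> with probability \<open>l i\<close> is optimal. The distribution \<open>L\<close> is determined by \<open>l\<close>.\<close>

definition optimal_all_to_one ::
    "nat \<Rightarrow> (nat \<Rightarrow> real) \<Rightarrow> 't set \<Rightarrow> ('t \<Rightarrow> real) \<Rightarrow> (nat \<Rightarrow> real) \<Rightarrow> bool" where
  "optimal_all_to_one n p T u l \<longleftrightarrow>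
     (\<exists>L :: nat pmf. set_pmf L \<subseteq> {1..n} \<and> (\<forall>i\<in>{1..n}. pmf L i = l i) \<and>
        optimal_strategy n p T u (map_pmf (all_to_worker T) L))"

definition ratio :: "(nat \<Rightarrow> real) \<Rightarrow> nat \<Rightarrow> real" where
  "ratio p k = (real k - 1) / (\<Sum>j=1..k. 1 / p j)"

definition k_star :: "nat \<Rightarrow> (nat \<Rightarrow> real) \<Rightarrow> nat" where
  "k_star n p = (LEAST k. is_arg_max (ratio p) (\<lambda>k. k \<in> {2..n}) k)"

definition lambda_star :: "nat \<Rightarrow> (nat \<Rightarrow> real) \<Rightarrow> nat \<Rightarrow> real" where
  "lambda_star n p i =
     (if 1 \<le> i \<and> i \<le> k_star n p then 1 / (p i * (\<Sum>j=1..k_star n p. 1 / p j)) else 0)"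


section \<open>A real random access machine with operation counts\<close>

text \<open>Programs have natural number variables, used as indices and counters, and arrays of reals.
  A real scalar is an array entry with a constant index. Every arithmetic operation, comparison,
  constant, variable or array access, assignment and control step costs one unit. Index arithmetic
  is restricted to addition and truncated subtraction. Real division is total, with
  \<open>x / 0 = 0\<close>; a preceding zero test would change costs by a constant factor only.\<close>

type_synonym vname = string
type_synonym mstate = "(vname \<Rightarrow> nat) \<times> (vname \<Rightarrow> nat \<Rightarrow> real)"

datatype nexp = N nat | V vname | NPlus nexp nexp | NMinus nexp nexp

datatype rexp =
    R int
  | Get vname nexp
  | Plus rexp rexp
  | Minus rexp rexp
  | Times rexp rexp
  | Divide rexp rexp

datatype bexp = NLess nexp nexp | RLess rexp rexp

datatype com =
    Skip
  | NAssign vname nexp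
  | RAssign vname nexp rexp
  | Seq com com
  | Cond bexp com com
  | While bexp com

primrec nval :: "nexp \<Rightarrow> mstate \<Rightarrow> nat" where
  "nval (N k) \<sigma> = k"
| "nval (V x) \<sigma> = fst \<sigma> x"
| "nval (NPlus a b) \<sigma> = nval a \<sigma> + nval b \<sigma>"
| "nval (NMinus a b) \<sigma> = nval a \<sigma> - nval b \<sigma>"

primrec rval :: "rexp \<Rightarrow> mstate \<Rightarrow> real" where
  "rval (R k) \<sigma> = of_int k"
| "rval (Get x i) \<sigma> = snd \<sigma> x (nval i \<sigma>)"
| "rval (Plus a b) \<sigma> = rval a \<sigma> + rval b \<sigma>"
| "rval (Minus a b) \<sigma> = rval a \<sigma> - rval b \<sigma>"
| "rval (Times a b) \<sigma> = rval a \<sigma> * rval b \<sigma>"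
| "rval (Divide a b) \<sigma> = rval a \<sigma> / rval b \<sigma>"

primrec bval :: "bexp \<Rightarrow> mstate \<Rightarrow> bool" where
  "bval (NLess a b) \<sigma> \<longleftrightarrow> nval a \<sigma> < nval b \<sigma>"
| "bval (RLess a b) \<sigma> \<longleftrightarrow> rval a \<sigma> < rval b \<sigma>"

primrec ncost :: "nexp \<Rightarrow> nat" where
  "ncost (N k) = 1"
| "ncost (V x) = 1"
| "ncost (NPlus a b) = 1 + ncost a + ncost b"
| "ncost (NMinus a b) = 1 + ncost a + ncost b"

primrec rcost :: "rexp \<Rightarrow> nat" where
  "rcost (R k) = 1"
| "rcost (Get x i) = 1 + ncost i"
| "rcost (Plus a b) = 1 + rcost a + rcost b"
| "rcost (Minus a b) = 1 + rcost a + rcost b"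
| "rcost (Times a b) = 1 + rcost a + rcost b"
| "rcost (Divide a b) = 1 + rcost a + rcost b"

primrec bcost :: "bexp \<Rightarrow> nat" where
  "bcost (NLess a b) = 1 + ncost a + ncost b"
| "bcost (RLess a b) = 1 + rcost a + rcost b"

text \<open>\<open>exec c \<sigma> \<tau> \<sigma>'\<close>: started in \<open>\<sigma>\<close>, program \<open>c\<close> halts in \<open>\<sigma>'\<close> at total cost \<open>\<tau>\<close>.\<close>

inductive exec :: "com \<Rightarrow> mstate \<Rightarrow> nat \<Rightarrow> mstate \<Rightarrow> bool" where
  Skip: "exec Skip \<sigma> 1 \<sigma>"
| NAssign: "exec (NAssign x a) \<sigma> (1 + ncost a) ((fst \<sigma>)(x := nval a \<sigma>), snd \<sigma>)"
| RAssign: "exec (RAssign x i a) \<sigma> (1 + ncost i + rcost a)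
    (fst \<sigma>, (snd \<sigma>)(x := (snd \<sigma> x)(nval i \<sigma> := rval a \<sigma>)))"
| Seq: "exec c1 \<sigma>1 t1 \<sigma>2 \<Longrightarrow> exec c2 \<sigma>2 t2 \<sigma>3 \<Longrightarrow> exec (Seq c1 c2) \<sigma>1 (1 + t1 + t2) \<sigma>3"
| IfTrue: "bval b \<sigma> \<Longrightarrow> exec c1 \<sigma> t \<sigma>' \<Longrightarrow> exec (Cond b c1 c2) \<sigma> (1 + bcost b + t) \<sigma>'"
| IfFalse: "\<not> bval b \<sigma> \<Longrightarrow> exec c2 \<sigma> t \<sigma>' \<Longrightarrow> exec (Cond b c1 c2) \<sigma> (1 + bcost b + t) \<sigma>'"
| WhileFalse: "\<not> bval b \<sigma> \<Longrightarrow> exec (While b c) \<sigma> (1 + bcost b) \<sigma>"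
| WhileTrue: "bval b \<sigma>1 \<Longrightarrow> exec c \<sigma>1 t1 \<sigma>2 \<Longrightarrow> exec (While b c) \<sigma>2 t2 \<sigma>3 \<Longrightarrow>
    exec (While b c) \<sigma>1 (1 + bcost b + t1 + t2) \<sigma>3"

text \<open>The input is \<open>n\<close> and \<open>p 1, \<dots>, p n\<close>; all other memory is zero. The output is read from
  the array \<open>q\<close>.\<close>

definition input_state :: "nat \<Rightarrow> (nat \<Rightarrow> real) \<Rightarrow> mstate" where
  "input_state n p =
     ((\<lambda>x. if x = ''n'' then n else 0),
      (\<lambda>x i. if x = ''p'' \<and> i \<in> {1..n} then p i else 0))"

definition output_vector :: "mstate \<Rightarrow> nat \<Rightarrow> real" where
  "output_vector \<sigma> = snd \<sigma> ''q''"

end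

theory Submission
  imports Defs
begin

text \<open>The bound on the value is linear programming duality. Let \<open>V\<close> be the maximal ratio. An
  attacker who attacks worker \<open>a \<le> k*\<close> with probability \<open>1 - V / p a\<close> leaves every worker with
  an effective proficiency of at most \<open>V\<close>, so the defender gets at most \<open>V * sum u T\<close>. The weights
  are nonnegative, and workers beyond \<open>k*\<close> may be left alone, because \<open>ratio p (k + 1)\<close> is a mediant
  of \<open>ratio p k\<close> and \<open>p (k + 1)\<close>: maximality of \<open>V\<close> gives \<open>p (k* + 1) \<le> V \<le> p k*\<close>.\<close>

section \<open>The maximal ratio\<close>

lemma proficiency_pos:
  assumes "proficiencies n p" "w \<in> {1..n}"
  shows "0 < p w"
proof -
  have "1 / 2 \<le> p w" using assms by (simp add: proficiencies_def)
  then show ?thesis by simp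
qed

lemma proficiency_antimono:
  assumes "proficiencies n p" "v \<in> {1..n}" "w \<in> {1..n}" "v \<le> w"
  shows "p w \<le> p v"
  using assms by (auto simp: proficiencies_def monotone_on_def)

lemma inverse_sum_pos:
  assumes "proficiencies n p" "1 \<le> k" "k \<le> n"
  shows "0 < (\<Sum>j=1..k. 1 / p j)"
  using assms proficiency_pos[OF assms(1)] by (intro sum_pos) auto

text \<open>The denominator is an empty sum, so the convention \<open>x / 0 = 0\<close> decides the
  value; the scan starts from it.\<close>

lemma ratio_0 [simp]: "ratio p 0 = 0"
  by (simp add: ratio_def)

lemma ratio_1 [simp]: "ratio p (Suc 0) = 0"
  by (simp add: ratio_def)

lemma ratio_Suc_compare:
  assumes p: "proficiencies n p" and k: "1 \<le> k" "Suc k \<le> n"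
  shows "ratio p k \<le> ratio p (Suc k) \<Longrightarrow> ratio p (Suc k) \<le> p (Suc k)"
    and "ratio p (Suc k) \<le> ratio p k \<Longrightarrow> p (Suc k) \<le> ratio p k"
proof -
  define H where "H = (\<Sum>j=1..k. 1 / p j)"
  have H: "0 < H" unfolding H_def using inverse_sum_pos[OF p] k by simp
  have pk: "0 < p (Suc k)" using proficiency_pos[OF p] k by simp
  have H': "0 < H + 1 / p (Suc k)" using H pk by (simp add: add_pos_pos)
  have "ratio p k * H = real k - 1"
    using H unfolding ratio_def H_def[symmetric] by simp
  moreover have "ratio p (Suc k) = real k / (H + 1 / p (Suc k))"
    by (simp add: ratio_def H_def)
  then have "ratio p (Suc k) * (H + 1 / p (Suc k)) = real k" using H' by simp
  \<comment> \<open>The mediant relation with denominators cleared. Replacing one of the two ratios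
    by the other turns it into each of the comparisons below.\<close>
  ultimately have e: "ratio p (Suc k) * (H + 1 / p (Suc k)) = ratio p k * H + 1" by simp
  show "ratio p (Suc k) \<le> p (Suc k)" if "ratio p k \<le> ratio p (Suc k)"
  proof -
    have "ratio p k * H \<le> ratio p (Suc k) * H" using that H by simp
    then have "ratio p (Suc k) * (1 / p (Suc k)) \<le> 1" using e by (simp add: distrib_left)
    then show ?thesis using pk by (simp add: field_simps)
  qed
  show "p (Suc k) \<le> ratio p k" if "ratio p (Suc k) \<le> ratio p k"
  proof -
    have "ratio p (Suc k) * (H + 1 / p (Suc k)) \<le> ratio p k * (H + 1 / p (Suc k))"
      using that H' by (intro mult_right_mono) auto
    then have "1 \<le> ratio p k * (1 / p (Suc k))" using e by (simp add: distrib_left)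
    then show ?thesis using pk by (simp add: field_simps)
  qed
qed

lemma is_arg_max_k_star:
  assumes "proficiencies n p"
  shows "is_arg_max (ratio p) (\<lambda>k. k \<in> {2..n}) (k_star n p)"
proof -
  have "finite {2..n}" "{2..n} \<noteq> {}" using assms by (auto simp: proficiencies_def)
  then have "Max (ratio p ` {2..n}) \<in> ratio p ` {2..n}" by (intro Max_in) auto
  then obtain k where "k \<in> {2..n}" "ratio p k = Max (ratio p ` {2..n})" by force
  then have "is_arg_max (ratio p) (\<lambda>k. k \<in> {2..n}) k" by (simp add: is_arg_max_linorder)
  then show ?thesis unfolding k_star_def by (rule LeastI)
qed

lemma k_star_range:
  assumes "proficiencies n p"
  shows "2 \<le> k_star n p" "k_star n p \<le> n"
  using is_arg_max_k_star[OF assms] by (auto simp: is_arg_max_def)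

lemma ratio_nonneg:
  assumes "proficiencies n p" "1 \<le> k" "k \<le> n"
  shows "0 \<le> ratio p k"
  using inverse_sum_pos[OF assms] assms by (simp add: ratio_def)

text \<open>Extends maximality to \<open>k = 1\<close>, outside the range of the maximization, so
  that \<open>k_star n p = 2\<close> can also be compared with its predecessor.\<close>

lemma ratio_le_k_star:
  assumes p: "proficiencies n p" and k: "1 \<le> k" "k \<le> n"
  shows "ratio p k \<le> ratio p (k_star n p)"
proof (cases "2 \<le> k")
  case True
  then show ?thesis using is_arg_max_k_star[OF p] k by (auto simp: is_arg_max_linorder)
next
  case False
  then have "k = Suc 0" using k by simp
  then show ?thesis using ratio_nonneg[OF p] k_star_range[OF p] by simp
qed

text \<open>Indices start at 0, so \<open>k = 0\<close> qualifies before the first step of a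
  scan.\<close>

definition first_max :: "(nat \<Rightarrow> real) \<Rightarrow> nat \<Rightarrow> nat \<Rightarrow> bool" where
  "first_max f i k \<longleftrightarrow> k \<le> i \<and> (\<forall>j\<le>i. f j \<le> f k) \<and> (\<forall>j<k. f j < f k)"

text \<open>A strict test keeps the old index on ties, which is what preserves leftmost
  maximizers.\<close>

lemma first_max_Suc:
  assumes "first_max f i k"
  shows "f k < f (Suc i) \<Longrightarrow> first_max f (Suc i) (Suc i)"
    and "\<not> f k < f (Suc i) \<Longrightarrow> first_max f (Suc i) k"
  using assms unfolding first_max_def le_Suc_eq less_Suc_eq_le
  by (meson le_less_trans less_imp_le order_refl, meson not_less order_refl)

text \<open>The junk indices 0 and 1 have ratio 0 and \<open>ratio p 2\<close> is positive, so the
  leftmost maximizer over \<open>{0..n}\<close> already lies in \<open>{2..n}\<close>.\<close>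

lemma first_max_ratio_eq_k_star:
  assumes p: "proficiencies n p" and k: "first_max (ratio p) n k"
  shows "k = k_star n p"
proof -
  have "k \<le> n" and max: "\<And>j. j \<le> n \<Longrightarrow> ratio p j \<le> ratio p k"
    and least: "\<And>j. j < k \<Longrightarrow> ratio p j < ratio p k"
    using k by (auto simp: first_max_def)
  have n: "2 \<le> n" using p by (simp add: proficiencies_def)
  have "0 < ratio p 2"
    using inverse_sum_pos[OF p, of 2] n by (simp add: ratio_def)
  then have pos: "0 < ratio p k" using max[OF n] by simp
  then have "k \<noteq> 0" "k \<noteq> Suc 0" by (metis ratio_0 less_irrefl, metis ratio_1 less_irrefl)
  then have "2 \<le> k" by simp
  then have "is_arg_max (ratio p) (\<lambda>k. k \<in> {2..n}) k"
    using \<open>k \<le> n\<close> max by (simp add: is_arg_max_linorder)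
  moreover have "k \<le> j" if "is_arg_max (ratio p) (\<lambda>k. k \<in> {2..n}) j" for j
  proof -
    have "ratio p k \<le> ratio p j"
      using that \<open>2 \<le> k\<close> \<open>k \<le> n\<close> by (simp add: is_arg_max_linorder)
    then show ?thesis using least[of j] by (meson not_le)
  qed
  ultimately show ?thesis unfolding k_star_def by (rule Least_equality[symmetric])
qed

lemma ratio_k_star_le_proficiency:
  assumes p: "proficiencies n p" and w: "1 \<le> w" "w \<le> k_star n p"
  shows "ratio p (k_star n p) \<le> p w"
proof -
  note k = k_star_range[OF p]
  obtain k' where k': "k_star n p = Suc k'" "1 \<le> k'" using k by (cases "k_star n p") auto
  have "ratio p k' \<le> ratio p (Suc k')"
    using ratio_le_k_star[OF p, of k'] k k' by simp
  then have "ratio p (k_star n p) \<le> p (k_star n p)"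
    using ratio_Suc_compare(1)[OF p] k k' by simp
  also have "\<dots> \<le> p w" using proficiency_antimono[OF p] w k by simp
  finally show ?thesis .
qed

lemma proficiency_le_ratio_k_star:
  assumes p: "proficiencies n p" and w: "k_star n p < w" "w \<le> n"
  shows "p w \<le> ratio p (k_star n p)"
proof -
  note k = k_star_range[OF p]
  have "p w \<le> p (Suc (k_star n p))" using proficiency_antimono[OF p] w k by simp
  also have "\<dots> \<le> ratio p (k_star n p)"
    using ratio_Suc_compare(2)[OF p] ratio_le_k_star[OF p, of "Suc (k_star n p)"] w k by simp
  finally show ?thesis .
qed

section \<open>Upper bound on the guaranteed utility\<close>

text \<open>On the support of \<open>q\<close> every matrix entry is 0 or 1, and the utility is
  linear in the entries.\<close>

lemma integrable_defender_utility:
  assumes "randomized_strategy n T q"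
  shows "integrable q (\<lambda>s. defender_utility n p T u s a)"
proof -
  have "integrable q (\<lambda>s. s w t)" if "w \<in> {1..n}" "t \<in> T" for w t
  proof (rule measure_pmf.integrable_const_bound[where B = 1])
    show "AE s in q. norm (s w t) \<le> 1"
      unfolding AE_measure_pmf_iff
    proof
      fix s assume "s \<in> set_pmf q"
      then have "s w t \<in> {0, 1}"
        using assms that unfolding randomized_strategy_def assignments_def by blast
      then show "norm (s w t) \<le> 1" by auto
    qed
  qed simp
  then show ?thesis unfolding defender_utility_def
    by (intro Bochner_Integration.integrable_sum integrable_mult_right integrable_mult_left) auto
qed

lemma guaranteed_utility_le:
  fixes T :: "'t set"
  assumes p: "proficiencies n p" and u: "task_utilities T u" and q: "randomized_strategy n T q"
  shows "guaranteed_utility n p T u q \<le> ratio p (k_star n p) * sum u T"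
proof -
  define k V where "k = k_star n p" and "V = ratio p k"
  \<comment> \<open>The attacker's mixed strategy: the weight on \<open>a \<le> k\<close> solves
    \<open>(1 - \<alpha> a) * p a = V\<close>.\<close>
  define \<alpha> where "\<alpha> a = (if a \<le> k then 1 - V / p a else 0)" for a
  define x where "x s w = (\<Sum>t\<in>T. s w t * u t)" for s :: "nat \<Rightarrow> 't \<Rightarrow> real" and w
  note k = k_star_range[OF p, folded k_def]
  have \<alpha>_nonneg: "0 \<le> \<alpha> a" if "a \<in> {1..n}" for a
    using that ratio_k_star_le_proficiency[OF p, of a] proficiency_pos[OF p, of a]
    by (auto simp: \<alpha>_def V_def k_def field_simps)
  have "(\<Sum>a=1..n. \<alpha> a) = (\<Sum>a=1..k. 1 - V / p a)"
    using k by (intro sum.mono_neutral_cong_right) (auto simp: \<alpha>_def)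
  also have "\<dots> = real k - V * (\<Sum>a=1..k. 1 / p a)"
    by (simp add: sum_subtractf sum_distrib_left)
  \<comment> \<open>By definition of \<open>ratio\<close>, \<open>V\<close> times the sum of
    inverses is \<open>k - 1\<close>.\<close>
  also have "\<dots> = 1"
    using inverse_sum_pos[OF p, of k] k by (simp add: V_def ratio_def)
  finally have \<alpha>_sum: "(\<Sum>a=1..n. \<alpha> a) = 1" .
  have eff: "(1 - \<alpha> w) * p w \<le> V" if "w \<in> {1..n}" for w
    using that proficiency_le_ratio_k_star[OF p, of w] proficiency_pos[OF p, of w]
    by (auto simp: \<alpha>_def V_def k_def)
  have bound: "(\<Sum>a=1..n. \<alpha> a * defender_utility n p T u s a) \<le> V * sum u T"
    if s: "s \<in> assignments n T" for s
  proof -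
    have x: "0 \<le> x s w" if w: "w \<in> {1..n}" for w
      unfolding x_def
    proof (intro sum_nonneg mult_nonneg_nonneg)
      fix t assume t: "t \<in> T"
      have "s w t \<in> {0, 1}" using s w t unfolding assignments_def by blast
      then show "0 \<le> s w t" by auto
      show "0 \<le> u t" using u t by (simp add: task_utilities_def)
    qed
    \<comment> \<open>Since each task has exactly one worker, the loads \<open>x s w\<close> add up
      to the total utility.\<close>
    have "(\<Sum>w=1..n. x s w) = (\<Sum>t\<in>T. (\<Sum>w=1..n. s w t) * u t)"
      unfolding x_def by (subst sum.swap) (simp add: sum_distrib_right)
    also have "\<dots> = sum u T"
      using s by (intro sum.cong) (auto simp: assignments_def)
    finally have total: "(\<Sum>w=1..n. x s w) = sum u T" .
    \<comment> \<open>An attack on \<open>a\<close> removes just the contribution of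
      \<open>a\<close>; averaging over attacks therefore scales the contribution of \<open>w\<close>
      by \<open>1 - \<alpha> w\<close>.\<close>
    have "(\<Sum>a=1..n. \<alpha> a * defender_utility n p T u s a)
        = (\<Sum>a=1..n. \<alpha> a * (\<Sum>w=1..n. p w * x s w) - \<alpha> a * (p a * x s a))"
      by (intro sum.cong) (auto simp: defender_utility_def x_def sum_diff1 algebra_simps)
    also have "\<dots> = (\<Sum>a=1..n. \<alpha> a) * (\<Sum>w=1..n. p w * x s w) - (\<Sum>a=1..n. \<alpha> a * (p a * x s a))"
      by (simp add: sum_subtractf sum_distrib_right)
    also have "\<dots> = (\<Sum>w=1..n. (1 - \<alpha> w) * p w * x s w)"
      unfolding \<alpha>_sum by (simp add: sum_subtractf left_diff_distrib mult.assoc)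
    also have "\<dots> \<le> (\<Sum>w=1..n. V * x s w)"
      by (intro sum_mono mult_right_mono eff x) auto
    finally show ?thesis unfolding sum_distrib_left[symmetric] total .
  qed
  define E where "E a = measure_pmf.expectation q (\<lambda>s. defender_utility n p T u s a)" for a
  \<comment> \<open>A minimum over attacks is at most the average with weights
    \<open>\<alpha>\<close>.\<close>
  have "guaranteed_utility n p T u q = (\<Sum>a=1..n. \<alpha> a * guaranteed_utility n p T u q)"
    unfolding sum_distrib_right[symmetric] \<alpha>_sum by simp
  also have "\<dots> \<le> (\<Sum>a=1..n. \<alpha> a * E a)"
    by (intro sum_mono mult_left_mono \<alpha>_nonneg) (auto simp: guaranteed_utility_def E_def)
  also have "\<dots> = measure_pmf.expectation q (\<lambda>s. \<Sum>a=1..n. \<alpha> a * defender_utility n p T u s a)"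
    unfolding E_def using integrable_defender_utility[OF q] by simp
  also have "\<dots> \<le> V * sum u T"
  proof (rule measure_pmf.integral_le_const)
    show "integrable q (\<lambda>s. \<Sum>a=1..n. \<alpha> a * defender_utility n p T u s a)"
      using integrable_defender_utility[OF q] by simp
    show "AE s in q. (\<Sum>a=1..n. \<alpha> a * defender_utility n p T u s a) \<le> V * sum u T"
      using q bound by (auto simp: AE_measure_pmf_iff randomized_strategy_def)
  qed
  finally show ?thesis by (simp add: V_def k_def)
qed

section \<open>The strategy attaining the bound\<close>

lemma all_to_worker_in_assignments:
  assumes "i \<in> {1..n}"
  shows "all_to_worker T i \<in> assignments n T"
  using assms by (auto simp: assignments_def all_to_worker_def)

lemma defender_utility_all_to_worker:
  assumes "i \<in> {1..n}"
  shows "defender_utility n p T u (all_to_worker T i) a = (if i = a then 0 else p i * sum u T)"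
proof -
  have "defender_utility n p T u (all_to_worker T i) a
      = (\<Sum>w\<in>{1..n} - {a}. if w = i then p i * sum u T else 0)"
    unfolding defender_utility_def all_to_worker_def by (intro sum.cong) auto
  then show ?thesis using assms by simp
qed

lemma lambda_star_nonneg:
  assumes "proficiencies n p"
  shows "0 \<le> lambda_star n p i"
  using k_star_range[OF assms] proficiency_pos[OF assms, of i] inverse_sum_pos[OF assms, of "k_star n p"]
  by (auto simp: lambda_star_def)

lemma sum_lambda_star:
  assumes p: "proficiencies n p"
  shows "(\<Sum>i=1..n. lambda_star n p i) = 1"
proof -
  define k H where "k = k_star n p" and "H = (\<Sum>j=1..k. 1 / p j)"
  note k = k_star_range[OF p, folded k_def]
  have H: "0 < H" using inverse_sum_pos[OF p, of k] k by (simp add: H_def)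
  have "(\<Sum>i=1..n. lambda_star n p i) = (\<Sum>i=1..k. (1 / p i) / H)"
    using k by (intro sum.mono_neutral_cong_right) (auto simp: lambda_star_def k_def H_def)
  also have "\<dots> = 1" using H by (simp only: sum_divide_distrib[symmetric] H_def[symmetric]) simp
  finally show ?thesis .
qed

text \<open>The weights equalize: each worker \<open>i \<le> k\<close> contributes
  \<open>U / H\<close>, and an attack removes at most one of these \<open>k\<close> equal
  terms.\<close>

lemma ratio_k_star_le_payoff:
  assumes p: "proficiencies n p" and U: "0 \<le> U"
  shows "ratio p (k_star n p) * U
    \<le> (\<Sum>i=1..n. lambda_star n p i * (if i = a then 0 else p i * U))"
proof -
  define k H where "k = k_star n p" and "H = (\<Sum>j=1..k. 1 / p j)"
  note k = k_star_range[OF p, folded k_def]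
  have H: "0 < H" using inverse_sum_pos[OF p, of k] k by (simp add: H_def)
  have "ratio p k * U = (\<Sum>i=1..k. U / H) - U / H"
    using H unfolding ratio_def H_def[symmetric] by (simp add: field_simps)
  \<comment> \<open>Strictness can occur only for \<open>a\<close> outside \<open>{1..k}\<close>,
    where nothing is lost.\<close>
  also have "\<dots> \<le> (\<Sum>i=1..k. U / H) - (\<Sum>i=1..k. if i = a then U / H else 0)"
    using H U by simp
  also have "\<dots> = (\<Sum>i=1..k. if i = a then 0 else U / H)"
    unfolding sum_subtractf[symmetric] by (intro sum.cong) auto
  also have "\<dots> = (\<Sum>i=1..n. lambda_star n p i * (if i = a then 0 else p i * U))"
  proof (intro sum.mono_neutral_cong_left)
    show "(if i = a then 0 else U / H) = lambda_star n p i * (if i = a then 0 else p i * U)"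
      if "i \<in> {1..k}" for i
      using that k proficiency_pos[OF p, of i] by (simp add: lambda_star_def k_def H_def)
  qed (use k in \<open>auto simp: lambda_star_def k_def\<close>)
  finally show ?thesis by (simp add: k_def)
qed

lemma optimal_all_to_one_lambda_star:
  assumes p: "proficiencies n p" and u: "task_utilities T u"
  shows "optimal_all_to_one n p T u (lambda_star n p)"
proof -
  define l where "l i = (if i \<in> {1..n} then lambda_star n p i else 0)" for i
  define L where "L = embed_pmf l"
  have l: "0 \<le> l i" for i using lambda_star_nonneg[OF p] by (simp add: l_def)
  have "(\<integral>\<^sup>+ i. ennreal (l i) \<partial>count_space UNIV) = (\<Sum>i\<in>{1..n}. ennreal (l i))"
    by (rule nn_integral_count_space') (auto simp: l_def)
  also have "\<dots> = ennreal (\<Sum>i=1..n. l i)" using l by (simp add: sum_ennreal)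
  also have "(\<Sum>i=1..n. l i) = 1" using sum_lambda_star[OF p] by (simp add: l_def)
  finally have mass: "(\<integral>\<^sup>+ i. ennreal (l i) \<partial>count_space UNIV) = 1" by simp
  have pmf_L: "pmf L i = l i" for i unfolding L_def by (rule pmf_embed_pmf[OF l mass])
  have set_L: "set_pmf L \<subseteq> {1..n}"
    by (auto simp: set_pmf_iff pmf_L l_def split: if_splits)
  define q where "q = map_pmf (all_to_worker T) L"
  have q: "randomized_strategy n T q"
    using set_L all_to_worker_in_assignments[of _ n T]
    by (auto simp: randomized_strategy_def q_def simp del: atLeastAtMost_iff)
  have "ratio p (k_star n p) * sum u T \<le> measure_pmf.expectation q (\<lambda>s. defender_utility n p T u s a)"
    for a
  proof -
    have "ratio p (k_star n p) * sum u T
        \<le> (\<Sum>i=1..n. lambda_star n p i * (if i = a then 0 else p i * sum u T))"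
      using u by (intro ratio_k_star_le_payoff[OF p] sum_nonneg) (auto simp: task_utilities_def)
    also have "\<dots> = (\<Sum>i=1..n. defender_utility n p T u (all_to_worker T i) a * pmf L i)"
      by (intro sum.cong) (auto simp: defender_utility_all_to_worker pmf_L l_def)
    also have "\<dots> = measure_pmf.expectation q (\<lambda>s. defender_utility n p T u s a)"
      unfolding q_def integral_map_pmf
      using set_L by (intro integral_measure_pmf_real[symmetric]) auto
    finally show ?thesis .
  qed
  then have "ratio p (k_star n p) * sum u T \<le> guaranteed_utility n p T u q"
    using p unfolding guaranteed_utility_def
    by (subst Min_ge_iff) (auto simp: proficiencies_def)
  \<comment> \<open>The guarantee of \<open>q\<close> reaches the upper bound valid for every
    randomized strategy.\<close>
  then have "optimal_strategy n p T u q"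
    unfolding optimal_strategy_def is_arg_max_linorder
    using q guaranteed_utility_le[OF p u] by (meson order_trans)
  then show ?thesis
    using set_L pmf_L unfolding optimal_all_to_one_def q_def
    by (intro exI[of _ L]) (auto simp: l_def)
qed

text \<open>Lets a program's output replace \<open>lambda_star\<close>, since only the entries
  \<open>1..n\<close> of its array are specified.\<close>

lemma optimal_all_to_one_cong:
  assumes "\<And>i. i \<in> {1..n} \<Longrightarrow> l i = l' i"
  shows "optimal_all_to_one n p T u l \<longleftrightarrow> optimal_all_to_one n p T u l'"
  using assms by (auto simp: optimal_all_to_one_def)

section \<open>Programs with bounded cost\<close>

text \<open>Total correctness with an upper bound on the cost, so that crude constants
  suffice.\<close>

definition halts :: "com \<Rightarrow> mstate \<Rightarrow> nat \<Rightarrow> (mstate \<Rightarrow> bool) \<Rightarrow> bool" where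
  "halts c \<sigma> K Q \<longleftrightarrow> (\<exists>\<tau> \<sigma>'. exec c \<sigma> \<tau> \<sigma>' \<and> \<tau> \<le> K \<and> Q \<sigma>')"

lemma halts_Seq:
  assumes "halts c1 \<sigma> K1 (\<lambda>\<sigma>'. halts c2 \<sigma>' K2 Q)"
  shows "halts (Seq c1 c2) \<sigma> (1 + K1 + K2) Q"
proof -
  obtain t1 \<sigma>1 t2 \<sigma>2 where 1: "exec c1 \<sigma> t1 \<sigma>1" "t1 \<le> K1"
    and 2: "exec c2 \<sigma>1 t2 \<sigma>2" "t2 \<le> K2" "Q \<sigma>2"
    using assms unfolding halts_def by blast
  show ?thesis unfolding halts_def
    using exec.Seq[OF 1(1) 2(1)] 1 2 by (intro exI conjI) auto
qed

lemma halts_conseq: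
  assumes "halts c \<sigma> K Q" "K \<le> K'" "\<And>\<sigma>'. Q \<sigma>' \<Longrightarrow> Q' \<sigma>'"
  shows "halts c \<sigma> K' Q'"
  using assms unfolding halts_def by (meson order_trans)

text \<open>A weakest precondition that the simplifier can evaluate on concrete loop bodies;
  \<open>False\<close> excludes nested loops.\<close>

primrec loop_free_wp :: "com \<Rightarrow> (mstate \<Rightarrow> bool) \<Rightarrow> mstate \<Rightarrow> bool" where
  "loop_free_wp Skip Q \<sigma> \<longleftrightarrow> Q \<sigma>"
| "loop_free_wp (NAssign x a) Q \<sigma> \<longleftrightarrow> Q ((fst \<sigma>)(x := nval a \<sigma>), snd \<sigma>)"
| "loop_free_wp (RAssign x i a) Q \<sigma> \<longleftrightarrow>
    Q (fst \<sigma>, (snd \<sigma>)(x := (snd \<sigma> x)(nval i \<sigma> := rval a \<sigma>)))"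
| "loop_free_wp (Seq c1 c2) Q \<sigma> \<longleftrightarrow> loop_free_wp c1 (loop_free_wp c2 Q) \<sigma>"
| "loop_free_wp (Cond b c1 c2) Q \<sigma> \<longleftrightarrow>
    (if bval b \<sigma> then loop_free_wp c1 Q \<sigma> else loop_free_wp c2 Q \<sigma>)"
| "loop_free_wp (While b c) Q \<sigma> \<longleftrightarrow> False"

text \<open>An overestimate that charges both branches of a conditional. The value for
  \<open>While\<close> is a dummy, harmless because its precondition is
  \<open>False\<close>.\<close>

primrec loop_free_cost :: "com \<Rightarrow> nat" where
  "loop_free_cost Skip = 1"
| "loop_free_cost (NAssign x a) = 1 + ncost a"
| "loop_free_cost (RAssign x i a) = 1 + ncost i + rcost a"
| "loop_free_cost (Seq c1 c2) = 1 + loop_free_cost c1 + loop_free_cost c2"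
| "loop_free_cost (Cond b c1 c2) = 1 + bcost b + loop_free_cost c1 + loop_free_cost c2"
| "loop_free_cost (While b c) = 0"

lemma halts_loop_free:
  "loop_free_wp c Q \<sigma> \<Longrightarrow> halts c \<sigma> (loop_free_cost c) Q"
proof (induction c arbitrary: Q \<sigma>)
  case Skip
  then show ?case using exec.Skip[of \<sigma>] unfolding halts_def by (intro exI conjI) auto
next
  case (NAssign x a)
  then show ?case using exec.NAssign[of x a \<sigma>] unfolding halts_def by (intro exI conjI) auto
next
  case (RAssign x i a)
  then show ?case using exec.RAssign[of x i a \<sigma>] unfolding halts_def by (intro exI conjI) auto
next
  case (Seq c1 c2)
  then have "halts c1 \<sigma> (loop_free_cost c1) (\<lambda>\<sigma>'. halts c2 \<sigma>' (loop_free_cost c2) Q)"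
    by (intro halts_conseq[OF Seq.IH(1) order_refl Seq.IH(2)]) simp
  from halts_Seq[OF this] show ?case by simp
next
  case (Cond b c1 c2)
  show ?case
  proof (cases "bval b \<sigma>")
    case True
    then have "halts c1 \<sigma> (loop_free_cost c1) Q" using Cond by simp
    then obtain t \<sigma>' where "exec c1 \<sigma> t \<sigma>'" "t \<le> loop_free_cost c1" "Q \<sigma>'"
      unfolding halts_def by blast
    with exec.IfTrue[OF True this(1)] show ?thesis
      unfolding halts_def by (intro exI conjI) auto
  next
    case False
    then have "halts c2 \<sigma> (loop_free_cost c2) Q" using Cond by simp
    then obtain t \<sigma>' where "exec c2 \<sigma> t \<sigma>'" "t \<le> loop_free_cost c2" "Q \<sigma>'"
      unfolding halts_def by blast
    with exec.IfFalse[OF False this(1)] show ?thesis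
      unfolding halts_def by (intro exI conjI) auto
  qed
next
  case (While b c)
  then show ?case by simp
qed

text \<open>The invariant is indexed by the number of completed passes, so the loop variable may
  count up or down. The last summand pays for the failing test.\<close>

lemma halts_While:
  assumes step: "\<And>i \<sigma>. I i \<sigma> \<Longrightarrow> i < m \<Longrightarrow> bval b \<sigma> \<and> halts c \<sigma> K (I (Suc i))"
    and stop: "\<And>\<sigma>. I m \<sigma> \<Longrightarrow> \<not> bval b \<sigma>"
    and "I i \<sigma>" "i \<le> m"
  shows "halts (While b c) \<sigma> ((m - i) * (1 + bcost b + K) + (1 + bcost b)) (I m)"
  using assms(3,4)
proof (induction "m - i" arbitrary: i \<sigma>)
  case 0
  then have "I m \<sigma>" by simp
  then show ?case unfolding halts_def
    using exec.WhileFalse[OF stop] by (intro exI[of _ "1 + bcost b"] exI[of _ \<sigma>]) simp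
next
  case (Suc d)
  then have "i < m" by simp
  from step[OF Suc.prems(1) this] obtain t1 \<sigma>1 where
    1: "bval b \<sigma>" "exec c \<sigma> t1 \<sigma>1" "t1 \<le> K" "I (Suc i) \<sigma>1" by (auto simp: halts_def)
  have d: "m - i = Suc (m - Suc i)" using \<open>i < m\<close> by simp
  have "halts (While b c) \<sigma>1 ((m - Suc i) * (1 + bcost b + K) + (1 + bcost b)) (I m)"
    using Suc.hyps(1)[of "Suc i" \<sigma>1] Suc.hyps(2) 1(4) \<open>i < m\<close> by simp
  then obtain t2 \<sigma>2 where
    2: "exec (While b c) \<sigma>1 t2 \<sigma>2" "t2 \<le> (m - Suc i) * (1 + bcost b + K) + (1 + bcost b)" "I m \<sigma>2"
    by (auto simp: halts_def)
  show ?case unfolding halts_def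
    using exec.WhileTrue[OF 1(1,2) 2(1)] 1(3) 2(2,3) d
    by (intro exI[of _ "1 + bcost b + t1 + t2"] exI[of _ \<sigma>2]) simp
qed

section \<open>A linear time program\<close>

text \<open>Scalars are array entries with index \<open>0\<close>: \<open>h\<close> is the sum of the inverse proficiencies read so
  far, \<open>c\<close> the loop counter \<open>i\<close> as a real, \<open>b\<close> the best ratio, attained first at \<open>k\<close>, and \<open>m\<close> the
  value of \<open>h\<close> at \<open>k\<close>. The scan starts from the junk value \<open>ratio p 0 = 0\<close>, which agrees with
  \<open>ratio p 1\<close> and is exceeded by \<open>ratio p 2\<close>.\<close>

definition scan_body :: com where
  "scan_body =
    Seq (NAssign ''i'' (NPlus (V ''i'') (N 1)))
    (Seq (RAssign ''h'' (N 0) (Plus (Get ''h'' (N 0)) (Divide (R 1) (Get ''p'' (V ''i'')))))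
    (Seq (Cond (RLess (Get ''b'' (N 0)) (Divide (Get ''c'' (N 0)) (Get ''h'' (N 0))))
      (Seq (NAssign ''k'' (V ''i''))
      (Seq (RAssign ''b'' (N 0) (Divide (Get ''c'' (N 0)) (Get ''h'' (N 0))))
        (RAssign ''m'' (N 0) (Get ''h'' (N 0)))))
      Skip)
    (RAssign ''c'' (N 0) (Plus (Get ''c'' (N 0)) (R 1)))))"

text \<open>Counting \<open>k\<close> down from \<open>k_star n p\<close> makes it both index and
  loop counter; cells beyond the start keep their initial 0.\<close>

definition fill_body :: com where
  "fill_body =
    Seq (RAssign ''q'' (V ''k'') (Divide (R 1) (Times (Get ''p'' (V ''k'')) (Get ''m'' (N 0)))))
    (NAssign ''k'' (NMinus (V ''k'') (N 1)))"

definition lambda_program :: com where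
  "lambda_program =
    Seq (While (NLess (V ''i'') (V ''n'')) scan_body) (While (NLess (N 0) (V ''k'')) fill_body)"

text \<open>The clause on \<open>q\<close> is carried along because its zeros are the final output
  for workers beyond \<open>k_star n p\<close>.\<close>

definition scan_inv :: "nat \<Rightarrow> (nat \<Rightarrow> real) \<Rightarrow> nat \<Rightarrow> mstate \<Rightarrow> bool" where
  "scan_inv n p i \<sigma> \<longleftrightarrow> fst \<sigma> ''n'' = n \<and> fst \<sigma> ''i'' = i \<and>
    (\<forall>j\<in>{1..n}. snd \<sigma> ''p'' j = p j) \<and> (\<forall>j. snd \<sigma> ''q'' j = 0) \<and>
    snd \<sigma> ''h'' 0 = (\<Sum>j=1..i. 1 / p j) \<and> snd \<sigma> ''c'' 0 = real i \<and>
    snd \<sigma> ''b'' 0 = ratio p (fst \<sigma> ''k'') \<and> snd \<sigma> ''m'' 0 = (\<Sum>j=1..fst \<sigma> ''k''. 1 / p j) \<and>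
    first_max (ratio p) i (fst \<sigma> ''k'')"

lemma scan_body_halts:
  assumes "scan_inv n p i \<sigma>" "i < n"
  shows "halts scan_body \<sigma> 100 (scan_inv n p (Suc i))"
proof (rule halts_conseq[OF halts_loop_free])
  \<comment> \<open>At the test \<open>c\<close> still holds the old counter, which is the numerator
    of the new ratio.\<close>
  have r: "real i / ((\<Sum>j=Suc 0..i. 1 / p j) + 1 / p (Suc i)) = ratio p (Suc i)"
    by (simp add: ratio_def)
  show "loop_free_wp scan_body (scan_inv n p (Suc i)) \<sigma>"
    using assms first_max_Suc[of "ratio p" i "fst \<sigma> ''k''"]
    by (simp add: scan_body_def scan_inv_def r)
qed (simp_all add: scan_body_def)

definition fill_inv :: "nat \<Rightarrow> (nat \<Rightarrow> real) \<Rightarrow> nat \<Rightarrow> mstate \<Rightarrow> bool" where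
  "fill_inv n p i \<sigma> \<longleftrightarrow> fst \<sigma> ''k'' = k_star n p - i \<and>
    (\<forall>j\<in>{1..n}. snd \<sigma> ''p'' j = p j) \<and> snd \<sigma> ''m'' 0 = (\<Sum>j=1..k_star n p. 1 / p j) \<and>
    (\<forall>j\<in>{1..n}. k_star n p - i < j \<longrightarrow> snd \<sigma> ''q'' j = lambda_star n p j)"

lemma fill_body_halts:
  assumes "proficiencies n p" "fill_inv n p i \<sigma>" "i < k_star n p"
  shows "halts fill_body \<sigma> 100 (fill_inv n p (Suc i))"
proof (rule halts_conseq[OF halts_loop_free])
  have "k_star n p - i \<in> {1..n}" "k_star n p - i \<le> k_star n p"
    using assms k_star_range[OF assms(1)] by auto
  then show "loop_free_wp fill_body (fill_inv n p (Suc i)) \<sigma>"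
    using assms by (simp add: fill_body_def fill_inv_def lambda_star_def)
qed (simp_all add: fill_body_def)

text \<open>Each loop makes at most \<open>n\<close> passes of cost at most 104, test included, and
  one failing test of cost 4; the constants round this up generously.\<close>

lemma lambda_program_halts:
  assumes p: "proficiencies n p"
  shows "halts lambda_program (input_state n p) (1000 * n)
    (\<lambda>\<sigma>. \<forall>i\<in>{1..n}. output_vector \<sigma> i = lambda_star n p i)"
proof -
  have n: "2 \<le> n" using p by (simp add: proficiencies_def)
  have fill: "halts (While (NLess (N 0) (V ''k'')) fill_body) \<sigma> (500 * n)
      (\<lambda>\<sigma>. \<forall>i\<in>{1..n}. output_vector \<sigma> i = lambda_star n p i)" if inv: "scan_inv n p n \<sigma>" for \<sigma>
  proof -
    have k: "fst \<sigma> ''k'' = k_star n p"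
      using inv by (intro first_max_ratio_eq_k_star[OF p]) (simp add: scan_inv_def)
    \<comment> \<open>With nothing written yet, only entries beyond \<open>k_star n p\<close> are
      claimed, and these are 0.\<close>
    have 0: "fill_inv n p 0 \<sigma>"
      using inv k by (auto simp: scan_inv_def fill_inv_def lambda_star_def)
    show ?thesis
    proof (rule halts_conseq[OF halts_While[where I = "fill_inv n p" and m = "k_star n p" and i = 0
          and K = 100]])
      show "bval (NLess (N 0) (V ''k'')) \<sigma> \<and> halts fill_body \<sigma> 100 (fill_inv n p (Suc i))"
        if "fill_inv n p i \<sigma>" "i < k_star n p" for i \<sigma>
        using that fill_body_halts[OF p that] by (simp add: fill_inv_def)
    qed (use 0 n k_star_range[OF p] in \<open>auto simp: fill_inv_def output_vector_def\<close>)
  qed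
  \<comment> \<open>Zeroed memory fits \<open>k = 0\<close>: the sums are empty and
    \<open>ratio p 0 = 0\<close>.\<close>
  have init: "scan_inv n p 0 (input_state n p)"
    by (simp add: scan_inv_def input_state_def first_max_def)
  have scan: "halts (While (NLess (V ''i'') (V ''n'')) scan_body) (input_state n p) (400 * n)
      (scan_inv n p n)"
  proof (rule halts_conseq[OF halts_While[where I = "scan_inv n p" and m = n and i = 0 and K = 100]])
    show "bval (NLess (V ''i'') (V ''n'')) \<sigma> \<and> halts scan_body \<sigma> 100 (scan_inv n p (Suc i))"
      if "scan_inv n p i \<sigma>" "i < n" for i \<sigma>
      using that scan_body_halts[OF that] by (simp add: scan_inv_def)
  qed (use init n in \<open>auto simp: scan_inv_def\<close>)
  show ?thesis unfolding lambda_program_def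
  proof (rule halts_conseq[OF halts_Seq])
    show "halts (While (NLess (V ''i'') (V ''n'')) scan_body) (input_state n p) (400 * n)
      (\<lambda>\<sigma>. halts (While (NLess (N 0) (V ''k'')) fill_body) \<sigma> (500 * n)
        (\<lambda>\<sigma>. \<forall>i\<in>{1..n}. output_vector \<sigma> i = lambda_star n p i))"
      by (rule halts_conseq[OF scan]) (use fill in auto)
  qed (use n in auto)
qed

theorem mainTheorem3:
  shows "(\<forall>(n::nat) (p::nat \<Rightarrow> real) (T::'t set) (u::'t \<Rightarrow> real).
            proficiencies n p \<longrightarrow> task_utilities T u \<longrightarrow>
            optimal_all_to_one n p T u (lambda_star n p)) \<and>
         (\<exists>(P::com) (C::nat). \<forall>(n::nat) (p::nat \<Rightarrow> real). proficiencies n p \<longrightarrow>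
            (\<exists>\<tau> \<sigma>. exec P (input_state n p) \<tau> \<sigma> \<and> \<tau> \<le> C * n \<and>
               (\<forall>(T::'t set) (u::'t \<Rightarrow> real). task_utilities T u \<longrightarrow>
                  optimal_all_to_one n p T u (output_vector \<sigma>))))"
proof (intro conjI allI impI)
  show "optimal_all_to_one n p T u (lambda_star n p)"
    if "proficiencies n p" "task_utilities T u" for n p and T :: "'t set" and u
    using that by (rule optimal_all_to_one_lambda_star)
  show "\<exists>(P::com) (C::nat). \<forall>(n::nat) (p::nat \<Rightarrow> real). proficiencies n p \<longrightarrow>
      (\<exists>\<tau> \<sigma>. exec P (input_state n p) \<tau> \<sigma> \<and> \<tau> \<le> C * n \<and>
        (\<forall>(T::'t set) (u::'t \<Rightarrow> real). task_utilities T u \<longrightarrow>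
          optimal_all_to_one n p T u (output_vector \<sigma>)))"
  \<comment> \<open>\<open>lambda_star\<close> does not depend on the tasks, so a single run serves
    every \<open>T\<close> and \<open>u\<close>.\<close>
  proof (rule exI[of _ lambda_program], rule exI[of _ "1000::nat"], intro allI impI)
    fix n p
    assume p: "proficiencies n p"
    obtain \<tau> \<sigma> where "exec lambda_program (input_state n p) \<tau> \<sigma>" "\<tau> \<le> 1000 * n"
      and out: "\<And>i. i \<in> {1..n} \<Longrightarrow> output_vector \<sigma> i = lambda_star n p i"
      using lambda_program_halts[OF p] by (auto simp: halts_def)
    moreover have "optimal_all_to_one n p T u (output_vector \<sigma>)"
      if "task_utilities T u" for T :: "'t set" and u
      using optimal_all_to_one_lambda_star[OF p that] out
        optimal_all_to_one_cong[of n "output_vector \<sigma>" "lambda_star n p"] by blast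
    ultimately show "\<exists>\<tau> \<sigma>. exec lambda_program (input_state n p) \<tau> \<sigma> \<and> \<tau> \<le> 1000 * n \<and>
        (\<forall>(T::'t set) (u::'t \<Rightarrow> real). task_utilities T u \<longrightarrow>
          optimal_all_to_one n p T u (output_vector \<sigma>))"
      by blast
  qed
qed

end
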